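(* Let $\mathbb S$ be a commutative semiring. A power series expression (of bounded degree) $P\in\mathbb S[[X_1,X_2,\dots]]$ is quasisymmetric, i.e. $P\in\mathrm{QSym}_{\mathbb S}$, if and only if $$\mathsf{zero}_n P=P\qquad\text{for all } n\ge1.$$
   Context: A commutative semiring $(\mathbb S,\oplus,\odot,\mathbf 0,\mathbf 1)$ consists of two commutative monoids $(\mathbb S,\oplus,\mathbf 0)$ and $(\mathbb S,\odot,\mathbf 1)$ such that $\odot$ distributes over $\oplus$ and $\mathbf 0\odot s=\mathbf 0$ for all $s$. $\mathbb S[[X_1,X_2,\dots]]$ denotes the commutative $\mathbb S$-semialgebra (with coefficientwise addition and Cauchy product) of formal power series $P=\sum_m P(m)\,m$, $P(m)\in\mathbb S$, over commutative monomials $m=X_{s_1}^{\alpha_1}\cdots X_{s_n}^{\alpha_n}$ in countably many variables, of bounded degree: there is $N$ with $P(m)=\mathbf 0$ whenever $|m|=\alpha_1+\dots+\alpha_n\ge N$. $P$ is quasisymmetric if for all $n\ge1$, $\alpha_1,\dots,\alpha_n\ge1$, $0<s_1<\dots<s_n$ and $0<t_1<\dots<t_n$ the coefficients in $P$ of $X_{s_1}^{\alpha_1}\cdots X_{s_n}^{\alpha_n}$ and $X_{t_1}^{\alpha_1}\cdots X_{t_n}^{\alpha_n}$ coincide. $\mathrm{QSym}_{\mathbb S}$ is the set of quasisymmetric elements. For $i\ge1$, $\mathsf{zero}_i:\mathbb S[[X_1,X_2,\dots]]\to\mathbb S[[X_1,X_2,\dots]]$ is the substitution morphism of $\mathbb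 S$-semialgebras given on variables by $\mathsf{zero}_i[X_j]=X_j$ if $j<i$, $\mathsf{zero}_i[X_i]=\mathbf 0$, and $\mathsf{zero}_i[X_j]=X_{j-1}$ if $j>i$ (extended multiplicatively to monomials and linearly to infinite sums). Equivalently, on coefficients, $(\mathsf{zero}_iP)(X_{t_1}^{\alpha_1}\cdots X_{t_n}^{\alpha_n})=P(X_{\sigma_i(t_1)}^{\alpha_1}\cdots X_{\sigma_i(t_n)}^{\alpha_n})$, where $\sigma_i(t)=t$ for $t<i$ and $\sigma_i(t)=t+1$ for $t\ge i$. *)

theory Defs
  imports "HOL-Library.Poly_Mapping"
begin

(* A monomial is a finitely supported exponent function on variable indices,
   so that addition of exponents is multiplication of monomials. *)

type_synonym monomial = "nat \<Rightarrow>\<^sub>0 nat"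

definition mdeg :: "monomial \<Rightarrow> nat" where
  "mdeg m = (\<Sum>j\<in>Poly_Mapping.keys m. Poly_Mapping.lookup m j)"

lemma mdeg_superset:
  "finite A \<Longrightarrow> Poly_Mapping.keys m \<subseteq> A \<Longrightarrow> mdeg m = (\<Sum>j\<in>A. Poly_Mapping.lookup m j)"
  unfolding mdeg_def by (rule sum.mono_neutral_left) (auto simp: in_keys_iff)

lemma mdeg_zero [simp]: "mdeg 0 = 0"
  by (simp add: mdeg_def)

lemma mdeg_add: "mdeg (a + b) = mdeg a + mdeg b"
proof -
  let ?A = "Poly_Mapping.keys a \<union> Poly_Mapping.keys b"
  have "mdeg (a + b) = (\<Sum>j\<in>?A. Poly_Mapping.lookup (a + b) j)"
    using keys_add[of a b] by (intro mdeg_superset) auto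
  also have "\<dots> = (\<Sum>j\<in>?A. Poly_Mapping.lookup a j) + (\<Sum>j\<in>?A. Poly_Mapping.lookup b j)"
    by (simp add: lookup_add sum.distrib)
  also have "\<dots> = mdeg a + mdeg b"
    by (simp add: mdeg_superset[of ?A a] mdeg_superset[of ?A b])
  finally show ?thesis .
qed

lemma mdeg_single [simp]: "mdeg (Poly_Mapping.single j k) = k"
  by (simp add: mdeg_def)

lemma keys_add_nat:
  "Poly_Mapping.keys (a + b) = Poly_Mapping.keys a \<union> Poly_Mapping.keys (b :: monomial)"
  by (auto simp: in_keys_iff lookup_add)

definition splits :: "monomial \<Rightarrow> (monomial \<times> monomial) set" where
  "splits m = {(a, b). a + b = m}"

lemma finite_splits [simp]: "finite (splits m)"
proof -
  define F where "F = {f. \<forall>j. (j \<in> Poly_Mapping.keys m \<longrightarrow> f j \<in> {..mdeg m}) \<and>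
    (j \<notin> Poly_Mapping.keys m \<longrightarrow> f j = (0::nat))}"
  have F: "finite F"
    unfolding F_def by (rule finite_set_of_finite_funs) auto
  have le: "Poly_Mapping.lookup m j \<le> mdeg m" for j
  proof (cases "j \<in> Poly_Mapping.keys m")
    case True
    then show ?thesis
      unfolding mdeg_def by (intro member_le_sum) simp_all
  qed (simp add: in_keys_iff)
  have le_add: "Poly_Mapping.lookup m j = Poly_Mapping.lookup a j + Poly_Mapping.lookup b j"
    if "a + b = m" for a b j
    using that by (auto simp: lookup_add)
  have *: "Poly_Mapping.lookup a \<in> F \<and> Poly_Mapping.lookup b \<in> F" if "a + b = m" for a b
  proof -
    have "Poly_Mapping.lookup a j \<le> mdeg m \<and> Poly_Mapping.lookup b j \<le> mdeg m" for j
      using le_add[OF that, of j] le[of j] by linarith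
    moreover have "Poly_Mapping.lookup a j = 0 \<and> Poly_Mapping.lookup b j = 0"
      if "j \<notin> Poly_Mapping.keys m" for j
      using le_add[OF \<open>a + b = m\<close>, of j] that by (simp add: in_keys_iff)
    ultimately show ?thesis unfolding F_def by auto
  qed
  define B where "B = Poly_Mapping.lookup -` F"
  have "finite B"
    unfolding B_def by (rule finite_vimageI[OF F]) (rule injI, rule poly_mapping_eqI, simp)
  then have "finite (B \<times> B)" by (rule finite_cartesian_product) fact
  moreover have "splits m \<subseteq> B \<times> B"
    using * unfolding splits_def B_def by blast
  ultimately show ?thesis by (rule rev_finite_subset)
qed

(* The power series of bounded degree in X_1, X_2, ....  There is no variable X_0: series
   have coefficient 0 at every exponent function that involves the index 0.
   The sort {comm_semiring_0,comm_monoid_mult} is that of commutative semirings with unit;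
   unlike comm_semiring_1 it does not impose 0 \<noteq> 1. *)

typedef (overloaded) 'a bseries =
  "{P :: monomial \<Rightarrow> 'a :: {comm_semiring_0,comm_monoid_mult}.
      (\<exists>N. \<forall>m. N \<le> mdeg m \<longrightarrow> P m = 0) \<and> (\<forall>m. 0 \<in> Poly_Mapping.keys m \<longrightarrow> P m = 0)}"
  morphisms coeff Abs_bseries
  by (rule exI[of _ "\<lambda>_. 0"]) auto

setup_lifting type_definition_bseries

lemma bseries_eqI: "(\<And>m. coeff P m = coeff Q m) \<Longrightarrow> P = Q"
  by (simp add: coeff_inject[symmetric] fun_eq_iff)

lemma coeff_index_0: "0 \<in> Poly_Mapping.keys m \<Longrightarrow> coeff P m = 0"
  using coeff[of P] by auto

lemma coeff_bounded: obtains N where "\<And>m. N \<le> mdeg m \<Longrightarrow> coeff P m = 0"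
  using coeff[of P] by auto

instantiation bseries :: ("{comm_semiring_0,comm_monoid_mult}") comm_semiring_0
begin

lift_definition zero_bseries :: "'a bseries" is "\<lambda>_. 0"
  by auto

lift_definition plus_bseries :: "'a bseries \<Rightarrow> 'a bseries \<Rightarrow> 'a bseries"
  is "\<lambda>P Q m. P m + Q m"
proof (intro conjI allI impI; clarsimp)
  fix P Q :: "monomial \<Rightarrow> 'a" and M N
  assume "\<forall>m. M \<le> mdeg m \<longrightarrow> P m = 0" "\<forall>m. N \<le> mdeg m \<longrightarrow> Q m = 0"
  then show "\<exists>N. \<forall>m. N \<le> mdeg m \<longrightarrow> P m + Q m = 0"
    by (intro exI[of _ "max M N"]) auto
qed

lift_definition times_bseries :: "'a bseries \<Rightarrow> 'a bseries \<Rightarrow> 'a bseries"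
  is "\<lambda>P Q m. \<Sum>(a, b)\<in>splits m. P a * Q b"
proof (intro conjI allI impI; clarsimp)
  fix P Q :: "monomial \<Rightarrow> 'a" and M N
  assume *: "\<forall>m. M \<le> mdeg m \<longrightarrow> P m = 0" "\<forall>m. N \<le> mdeg m \<longrightarrow> Q m = 0"
  have "(\<Sum>(a, b)\<in>splits m. P a * Q b) = 0" if "M + N \<le> mdeg m" for m
  proof (rule sum.neutral, clarify)
    fix a b assume "(a, b) \<in> splits m"
    then have "mdeg a + mdeg b = mdeg m" by (auto simp: splits_def mdeg_add)
    then have "M \<le> mdeg a \<or> N \<le> mdeg b" using that by linarith
    then show "P a * Q b = 0" using * by auto
  qed
  then show "\<exists>N. \<forall>m. N \<le> mdeg m \<longrightarrow> (\<Sum>(a, b)\<in>splits m. P a * Q b) = 0" by blast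
next
  fix P Q :: "monomial \<Rightarrow> 'a" and m :: monomial
  assume *: "\<forall>m. 0 \<in> Poly_Mapping.keys m \<longrightarrow> P m = 0" "\<forall>m. 0 \<in> Poly_Mapping.keys m \<longrightarrow> Q m = 0" "0 \<in> Poly_Mapping.keys m"
  show "(\<Sum>(a, b)\<in>splits m. P a * Q b) = 0"
    by (rule sum.neutral) (use * in \<open>auto simp: splits_def keys_add_nat\<close>)
qed

instance
proof
  fix P Q R :: "'a bseries"
  show "P + Q + R = P + (Q + R)" by transfer (simp add: add.assoc)
  show "P + Q = Q + P" by transfer (simp add: add.commute)
  show "0 + P = P" by transfer simp
  show "0 * P = 0" by transfer simp
  show "P * 0 = 0" by transfer simp
  show "(P + Q) * R = P * R + Q * R"
    by transfer (auto simp: distrib_right sum.distrib case_prod_unfold)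
  show "P * Q = Q * P"
  proof (rule bseries_eqI)
    fix m
    show "coeff (P * Q) m = coeff (Q * P) m"
      unfolding times_bseries.rep_eq
      by (rule sum.reindex_bij_witness[of _ prod.swap prod.swap])
         (auto simp: splits_def add.commute mult.commute)
  qed
  show "P * Q * R = P * (Q * R)"
  proof (rule bseries_eqI)
    fix m
    have "coeff (P * Q * R) m =
        (\<Sum>(x, y)\<in>splits m. \<Sum>(a, b)\<in>splits x. coeff P a * coeff Q b * coeff R y)"
      by (simp add: times_bseries.rep_eq sum_distrib_right case_prod_unfold)
    also have "\<dots> = (\<Sum>((x, y), (a, b))\<in>Sigma (splits m) (\<lambda>(x, y). splits x).
                     coeff P a * coeff Q b * coeff R y)"
      by (subst sum.Sigma[symmetric]) (auto simp: case_prod_unfold)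
    also have "\<dots> = (\<Sum>((x, y), (a, b))\<in>Sigma (splits m) (\<lambda>(x, y). splits y).
                     coeff P x * (coeff Q a * coeff R b))"
      by (rule sum.reindex_bij_witness[of _
            "\<lambda>((x, y), (a, b)). ((x + a, b), (x, a))" "\<lambda>((x, y), (a, b)). ((a, b + y), (b, y))"])
         (auto simp: splits_def add.assoc mult.assoc)
    also have "\<dots> = (\<Sum>(x, y)\<in>splits m. \<Sum>(a, b)\<in>splits y. coeff P x * (coeff Q a * coeff R b))"
      by (subst sum.Sigma[symmetric]) (auto simp: case_prod_unfold)
    also have "\<dots> = coeff (P * (Q * R)) m"
      by (simp add: times_bseries.rep_eq sum_distrib_left case_prod_unfold)
    finally show "coeff (P * Q * R) m = coeff (P * (Q * R)) m" .
  qed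
qed

end

lift_definition monom_series :: "monomial \<Rightarrow> 'a :: {comm_semiring_0,comm_monoid_mult} bseries"
  is "\<lambda>m k. if 0 \<notin> Poly_Mapping.keys m \<and> k = m then 1 else 0"
proof (intro conjI allI impI)
  fix m :: monomial
  show "\<exists>N. \<forall>k. N \<le> mdeg k \<longrightarrow> (if 0 \<notin> Poly_Mapping.keys m \<and> k = m then 1 else 0) = (0 :: 'a)"
    by (rule exI[of _ "Suc (mdeg m)"]) auto
qed auto

lemma coeff_monom_series:
  "coeff (monom_series m) k = (if 0 \<notin> Poly_Mapping.keys m \<and> k = m then 1 else 0)"
  by (simp add: monom_series.rep_eq)

lemma monom_series_mult:
  "monom_series a * monom_series b =
   (monom_series (a + b) :: 'a :: {comm_semiring_0,comm_monoid_mult} bseries)"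
proof (rule bseries_eqI)
  fix m
  have "coeff (monom_series a * monom_series b :: 'a bseries) m =
      (\<Sum>p\<in>splits m. if p = (a, b) then (if 0 \<notin> Poly_Mapping.keys (a + b) then 1 else 0) else 0)"
    unfolding times_bseries.rep_eq
    by (rule sum.cong) (auto simp: coeff_monom_series keys_add_nat split: if_splits)
  also have "\<dots> = coeff (monom_series (a + b)) m"
  proof -
    have "(a, b) \<in> splits m \<longleftrightarrow> m = a + b" by (auto simp: splits_def)
    then show ?thesis by (simp add: coeff_monom_series)
  qed
  finally show "coeff (monom_series a * monom_series b) m =
      coeff (monom_series (a + b) :: 'a bseries) m" .
qed

instantiation bseries :: ("{comm_semiring_0,comm_monoid_mult}") comm_monoid_mult
begin

definition one_bseries :: "'a bseries" where
  "one_bseries = monom_series 0"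

instance
proof
  fix P :: "'a bseries"
  show "1 * P = P"
  proof (rule bseries_eqI)
    fix m
    have "coeff (1 * P) m = (\<Sum>p\<in>splits m. if p = (0, m) then coeff P m else 0)"
      unfolding times_bseries.rep_eq one_bseries_def
      by (rule sum.cong) (auto simp: coeff_monom_series splits_def split: if_splits)
    also have "\<dots> = coeff P m"
    proof -
      have "(0, m) \<in> splits m" by (simp add: splits_def)
      then show ?thesis by simp
    qed
    finally show "coeff (1 * P) m = coeff P m" .
  qed
qed

end

(* The value at the junk index 0 is the zero series. *)
definition var :: "nat \<Rightarrow> 'a :: {comm_semiring_0,comm_monoid_mult} bseries" where
  "var j = monom_series (Poly_Mapping.single j 1)"

definition zero_var :: "nat \<Rightarrow> nat \<Rightarrow> 'a :: {comm_semiring_0,comm_monoid_mult} bseries" where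
  "zero_var i j = (if j < i then var j else if j = i then 0 else var (j - 1))"

definition zero_mon :: "nat \<Rightarrow> monomial \<Rightarrow> 'a :: {comm_semiring_0,comm_monoid_mult} bseries" where
  "zero_mon i m = (\<Prod>j\<in>Poly_Mapping.keys m. zero_var i j ^ Poly_Mapping.lookup m j)"

definition homogeneous :: "nat \<Rightarrow> 'a :: {comm_semiring_0,comm_monoid_mult} bseries \<Rightarrow> bool" where
  "homogeneous d P \<longleftrightarrow> (\<forall>m. coeff P m \<noteq> 0 \<longrightarrow> mdeg m = d)"

lemma homogeneous_one: "homogeneous 0 1"
  by (auto simp: homogeneous_def one_bseries_def coeff_monom_series split: if_splits)

lemma homogeneous_mult:
  assumes "homogeneous d P" "homogeneous e Q"
  shows "homogeneous (d + e) (P * Q)"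
  unfolding homogeneous_def
proof (intro allI impI)
  fix m assume "coeff (P * Q) m \<noteq> 0"
  then obtain p where "p \<in> splits m" "(case p of (a, b) \<Rightarrow> coeff P a * coeff Q b) \<noteq> 0"
    unfolding times_bseries.rep_eq by (meson sum.not_neutral_contains_not_neutral)
  then obtain a b where "a + b = m" "coeff P a * coeff Q b \<noteq> 0"
    by (auto simp: splits_def)
  moreover from this have "coeff P a \<noteq> 0" "coeff Q b \<noteq> 0" by auto
  ultimately show "mdeg m = d + e"
    using assms by (auto simp: homogeneous_def mdeg_add)
qed

lemma homogeneous_power: "homogeneous d P \<Longrightarrow> homogeneous (d * k) (P ^ k)"
  by (induction k) (auto simp: homogeneous_one dest: homogeneous_mult)

lemma homogeneous_zero_var: "homogeneous 1 (zero_var i j)"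
  by (auto simp: homogeneous_def zero_var_def var_def coeff_monom_series zero_bseries.rep_eq
           split: if_splits)

lemma homogeneous_zero_mon:
  "homogeneous (mdeg m) (zero_mon i m :: 'a :: {comm_semiring_0,comm_monoid_mult} bseries)"
proof -
  have "homogeneous (\<Sum>j\<in>A. Poly_Mapping.lookup m j) 
      (\<Prod>j\<in>A. zero_var i j ^ Poly_Mapping.lookup m j :: 'a bseries)" if "finite A" for A
    using that
  proof induction
    case (insert x A)
    then show ?case
      using homogeneous_mult[OF homogeneous_power[OF homogeneous_zero_var] insert.IH]
      by simp
  qed (simp add: homogeneous_one)
  then show ?thesis by (simp add: zero_mon_def mdeg_def)
qed

(* The substitution morphism zero_i: the linear extension of zero_mon i, that is, the series
   sum over m' of P(m') . zero_i[m'], computed coefficientwise.  As the proof of coeff_zero_subst shows,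
   at most one summand contributes to each coefficient if i > 0, so the support of Sum_any is
   finite and its default value 0 on infinite support is never used. *)
lift_definition zero_subst ::
    "nat \<Rightarrow> 'a :: {comm_semiring_0,comm_monoid_mult} bseries \<Rightarrow> 'a bseries"
  is "\<lambda>i P m. Sum_any (\<lambda>m'. P m' * coeff (zero_mon i m') m)"
proof (intro conjI allI impI; clarsimp)
  fix i N and P :: "monomial \<Rightarrow> 'a"
  assume P: "\<forall>m. N \<le> mdeg m \<longrightarrow> P m = 0"
  have "P m' * coeff (zero_mon i m') m = 0" if "N \<le> mdeg m" for m m'
    using homogeneous_zero_mon[of m' i, where 'a = 'a] P that
    by (cases "coeff (zero_mon i m') m = (0 :: 'a)") (auto simp: homogeneous_def)
  then show "\<exists>N. \<forall>m. N \<le> mdeg m \<longrightarrow> Sum_any (\<lambda>m'. P m' * coeff (zero_mon i m') m) = 0"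
    by (intro exI[of _ N]) simp
next
  fix i and P :: "monomial \<Rightarrow> 'a" and m :: monomial
  assume "0 \<in> Poly_Mapping.keys m"
  then show "Sum_any (\<lambda>m'. P m' * coeff (zero_mon i m') m) = 0"
    by (simp add: coeff_index_0)
qed

lemma var_power: "var j ^ k = monom_series (Poly_Mapping.single j k)" if "j > 0 \<or> k > 0"
  using that
proof (induction k)
  case (Suc k)
  then show ?case
    by (cases "k = 0")
       (auto simp: var_def monom_series_mult single_add[symmetric])
qed (auto simp: one_bseries_def)

lemma monom_series_prod:
  "finite A \<Longrightarrow> (\<Prod>j\<in>A. monom_series (f j)) = monom_series (\<Sum>j\<in>A. f j)"
  by (induction rule: finite_induct) (auto simp: one_bseries_def monom_series_mult)

lemma zero_mon_eq:
  assumes "i > 0"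
  shows "zero_mon i m = (if i \<in> Poly_Mapping.keys m then 0 else
           monom_series (\<Sum>j\<in>Poly_Mapping.keys m. Poly_Mapping.single (if j < i then j else j - 1) (Poly_Mapping.lookup m j)))"
proof (cases "i \<in> Poly_Mapping.keys m")
  case True
  then have "zero_var i i ^ Poly_Mapping.lookup m i = (0 :: 'a bseries)"
    by (cases "Poly_Mapping.lookup m i") (auto simp: zero_var_def in_keys_iff)
  with True show ?thesis
    unfolding zero_mon_def by (subst prod.remove[of _ i]) auto
next
  case False
  have "zero_mon i m =
     (\<Prod>j\<in>Poly_Mapping.keys m. monom_series (Poly_Mapping.single (if j < i then j else j - 1) (Poly_Mapping.lookup m j)))"
    unfolding zero_mon_def
    by (rule prod.cong) (use False in \<open>auto simp: zero_var_def var_power in_keys_iff\<close>)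
  with False show ?thesis by (simp add: monom_series_prod)
qed

definition sigma :: "nat \<Rightarrow> nat \<Rightarrow> nat" where
  "sigma i t = (if t < i then t else t + 1)"

lemma coeff_zero_subst:
  fixes P :: "'a :: {comm_semiring_0,comm_monoid_mult} bseries"
  assumes i: "i > 0" and A: "finite A" and s: "\<And>k. k \<in> A \<Longrightarrow> s k > 0"
  shows "coeff (zero_subst i P) (\<Sum>k\<in>A. Poly_Mapping.single (s k) (\<alpha> k)) =
         coeff P (\<Sum>k\<in>A. Poly_Mapping.single (sigma i (s k)) (\<alpha> k))"
    (is "coeff _ ?m = coeff P ?m'")
proof -
  define \<delta> where "\<delta> j = (if j < i then j else j - 1)" for j :: nat
  define \<rho> where "\<rho> m = (\<Sum>j\<in>Poly_Mapping.keys m. Poly_Mapping.single (\<delta> j) (Poly_Mapping.lookup m j))" for m :: monomial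
  have \<delta>\<sigma>: "\<delta> (sigma i t) = t" for t
    by (auto simp: \<delta>_def sigma_def)
  have \<sigma>\<delta>: "sigma i (\<delta> j) = j" if "j \<noteq> i" for j
    using that i by (auto simp: \<delta>_def sigma_def)
  have \<sigma>i: "sigma i t \<noteq> i" for t
    by (auto simp: sigma_def)
  have \<rho>_lookup: "Poly_Mapping.lookup (\<rho> m) t = Poly_Mapping.lookup m (sigma i t)" if "i \<notin> Poly_Mapping.keys m" for m t
  proof -
    have "Poly_Mapping.lookup (\<rho> m) t = (\<Sum>j\<in>Poly_Mapping.keys m. if j = sigma i t then Poly_Mapping.lookup m j else 0)"
      unfolding \<rho>_def lookup_sum
    proof (rule sum.cong)
      fix j assume "j \<in> Poly_Mapping.keys m"
      then have "\<delta> j = t \<longleftrightarrow> j = sigma i t"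
        using that \<delta>\<sigma> \<sigma>\<delta> by metis
      then show "Poly_Mapping.lookup (Poly_Mapping.single (\<delta> j) (Poly_Mapping.lookup m j)) t =
          (if j = sigma i t then Poly_Mapping.lookup m j else 0)"
        by (simp add: lookup_single when_def)
    qed simp
    also have "\<dots> = Poly_Mapping.lookup m (sigma i t)"
      by (auto simp: in_keys_iff)
    finally show ?thesis .
  qed
  have m_lookup: "Poly_Mapping.lookup ?m t = Poly_Mapping.lookup ?m' (sigma i t)" for t
    unfolding lookup_sum
  proof (rule sum.cong)
    fix k
    have "s k = t \<longleftrightarrow> sigma i (s k) = sigma i t"
      using \<delta>\<sigma> by metis
    then show "Poly_Mapping.lookup (Poly_Mapping.single (s k) (\<alpha> k)) t =
        Poly_Mapping.lookup (Poly_Mapping.single (sigma i (s k)) (\<alpha> k)) (sigma i t)"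
      by (simp add: lookup_single when_def)
  qed simp
  have m'_i: "Poly_Mapping.lookup ?m' i = 0"
    by (simp add: lookup_sum lookup_single \<sigma>i)
  have m_0: "0 \<notin> Poly_Mapping.keys ?m"
  proof -
    have "Poly_Mapping.lookup ?m 0 = 0"
      unfolding lookup_sum by (rule sum.neutral) (use s in \<open>fastforce simp: lookup_single\<close>)
    then show ?thesis by (simp add: in_keys_iff)
  qed
  have eq: "\<rho> m = ?m \<longleftrightarrow> m = ?m'" if "i \<notin> Poly_Mapping.keys m" for m
  proof
    assume "\<rho> m = ?m"
    then have *: "Poly_Mapping.lookup m (sigma i t) = Poly_Mapping.lookup ?m' (sigma i t)" for t
      using \<rho>_lookup[OF that, of t] m_lookup[of t] by simp
    have "Poly_Mapping.lookup m j = Poly_Mapping.lookup ?m' j" for j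
      using *[of "\<delta> j"] that m'_i by (cases "j = i") (auto simp: \<sigma>\<delta> in_keys_iff)
    then show "m = ?m'" by (rule poly_mapping_eqI)
  next
    assume "m = ?m'"
    then have "Poly_Mapping.lookup (\<rho> m) t = Poly_Mapping.lookup ?m t" for t
      using \<rho>_lookup[OF that, of t] m_lookup[of t] by simp
    then show "\<rho> m = ?m" by (rule poly_mapping_eqI)
  qed
  have zm: "zero_mon i m = (if i \<in> Poly_Mapping.keys m then 0 else monom_series (\<rho> m) :: 'a bseries)" for m
    unfolding \<rho>_def \<delta>_def by (rule zero_mon_eq[OF i])
  have "coeff P m * coeff (zero_mon i m) ?m = (if m = ?m' then coeff P m else 0)" for m
  proof (cases "i \<in> Poly_Mapping.keys m")
    case True
    then have "m \<noteq> ?m'" using m'_i by (auto simp: in_keys_iff)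
    with True show ?thesis by (simp add: zm zero_bseries.rep_eq)
  next
    case False
    have "(0 \<notin> Poly_Mapping.keys (\<rho> m) \<and> ?m = \<rho> m) \<longleftrightarrow> m = ?m'"
      using eq[OF False] m_0 by metis
    with False show ?thesis by (simp add: zm coeff_monom_series)
  qed
  then show ?thesis
    by (simp add: zero_subst.rep_eq)
qed

definition QSym :: "'a :: {comm_semiring_0,comm_monoid_mult} bseries set" where
  "QSym = {P. \<forall>n \<ge> 1. \<forall>\<alpha> s t :: nat \<Rightarrow> nat.
     (\<forall>k\<in>{1..n}. 1 \<le> \<alpha> k) \<longrightarrow>
     (\<forall>k\<in>{1..n}. 0 < s k) \<longrightarrow> strict_mono_on {1..n} s \<longrightarrow>
     (\<forall>k\<in>{1..n}. 0 < t k) \<longrightarrow> strict_mono_on {1..n} t \<longrightarrow>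
     coeff P (\<Sum>k=1..n. Poly_Mapping.single (s k) (\<alpha> k)) =
     coeff P (\<Sum>k=1..n. Poly_Mapping.single (t k) (\<alpha> k))}"

end

theory Submission
  imports Defs "HOL-Library.Infinite_Set"
begin

text \<open>
  On coefficients, \<open>zero\<^sub>i\<close> opens a gap at index \<open>i\<close> in a monomial. Quasisymmetry makes coefficients
  insensitive to such a gap. Conversely, if all gaps can be closed, then the coefficient of
  a monomial with indices \<open>s\<^sub>1 < \<dots> < s\<^sub>n\<close> equals that of the packed monomial with
  indices \<open>1 < \<dots> < n\<close> and the same exponents, whatever the \<open>s\<^sub>k\<close> are.
\<close>

text \<open>The increasing enumeration of the support supplies \<open>s\<close>, shifted to start at
  1. This lets an equality of series be checked on monomials of the shape used in
  \<open>QSym\<close>; the constant monomial is covered by \<open>n = 0\<close>.\<close>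

lemma monomial_strict_mono_form:
  fixes m :: monomial
  assumes "0 \<notin> Poly_Mapping.keys m"
  obtains n :: nat and s \<alpha> where
    "strict_mono_on {1..n} s" "\<forall>k\<in>{1..n}. 0 < s k" "\<forall>k\<in>{1..n}. 1 \<le> \<alpha> k"
    "m = (\<Sum>k=1..n. Poly_Mapping.single (s k) (\<alpha> k))"
proof -
  let ?K = "Poly_Mapping.keys m"
  obtain h where h: "bij_betw h {1..card ?K} ?K" "strict_mono_on {1..card ?K} h"
  proof -
    obtain g where g: "bij_betw g {..<card ?K} ?K" "strict_mono_on {..<card ?K} g"
      using ex_bij_betw_strict_mono_card[of ?K] by auto
    have "bij_betw (\<lambda>k. k - 1) {1..card ?K} {..<card ?K}"
      by (rule bij_betw_byWitness[of _ Suc]) auto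
    from bij_betw_trans[OF this g(1)] have "bij_betw (g \<circ> (\<lambda>k. k - 1)) {1..card ?K} ?K" .
    moreover have "strict_mono_on {1..card ?K} (g \<circ> (\<lambda>k. k - 1))"
      by (auto intro!: strict_mono_onI strict_mono_onD[OF g(2)])
    ultimately show thesis by (rule that)
  qed
  have in_keys: "h k \<in> ?K" if "k \<in> {1..card ?K}" for k
    using bij_betwE[OF h(1)] that by blast
  have "m = (\<Sum>j\<in>?K. Poly_Mapping.single j (Poly_Mapping.lookup m j))"
    by (rule poly_mapping_eqI) (auto simp: lookup_sum lookup_single when_def in_keys_iff)
  also have "\<dots> = (\<Sum>k=1..card ?K. Poly_Mapping.single (h k) (Poly_Mapping.lookup m (h k)))"
    by (rule sum.reindex_bij_betw[OF h(1), symmetric])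
  finally have "m = \<dots>" .
  moreover have "\<forall>k\<in>{1..card ?K}. 0 < h k"
    using in_keys assms by (metis gr0I)
  moreover have "\<forall>k\<in>{1..card ?K}. 1 \<le> Poly_Mapping.lookup m (h k)"
    using in_keys by (simp add: in_keys_iff Suc_le_eq)
  ultimately show thesis
    using h(2) by (intro that)
qed

lemma strict_mono_sigma: "strict_mono (sigma i)"
  by (auto simp: strict_mono_def sigma_def)

text \<open>Opening a gap with \<open>sigma i\<close> keeps indices positive and strictly increasing
  and leaves the exponent sequence alone, so quasisymmetry equates the two coefficients.\<close>

lemma zero_subst_QSym:
  fixes P :: "'a :: {comm_semiring_0,comm_monoid_mult} bseries"
  assumes "P \<in> QSym" "i \<ge> 1"
  shows "zero_subst i P = P"
proof (rule bseries_eqI)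
  fix m
  show "coeff (zero_subst i P) m = coeff P m"
  proof (cases "0 \<in> Poly_Mapping.keys m")
    case False
    then obtain n :: nat and s \<alpha> where s: "strict_mono_on {1..n} s" "\<forall>k\<in>{1..n}. 0 < s k"
      and \<alpha>: "\<forall>k\<in>{1..n}. 1 \<le> \<alpha> k"
      and m: "m = (\<Sum>k=1..n. Poly_Mapping.single (s k) (\<alpha> k))"
      by (rule monomial_strict_mono_form)
    have "coeff (zero_subst i P) m = coeff P (\<Sum>k=1..n. Poly_Mapping.single (sigma i (s k)) (\<alpha> k))"
      unfolding m using assms(2) s(2) by (intro coeff_zero_subst) auto
    also have "\<dots> = coeff P m"
    \<comment> \<open>Quasisymmetry only speaks of \<open>n \<ge> 1\<close>; for
      \<open>n = 0\<close> both sums are empty.\<close>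
    proof (cases "n = 0")
      case False
      have "strict_mono_on {1..n} (\<lambda>k. sigma i (s k))"
        by (auto intro!: strict_mono_onI strict_monoD[OF strict_mono_sigma] strict_mono_onD[OF s(1)])
      moreover have "\<forall>k\<in>{1..n}. 0 < sigma i (s k)"
        using s(2) by (auto simp: sigma_def)
      moreover have "1 \<le> n" using False by simp
      ultimately show ?thesis
        unfolding m using s \<alpha>
        by (intro assms(1)[unfolded QSym_def mem_Collect_eq, rule_format]) blast+
    qed (simp add: m)
    finally show ?thesis .
  qed (simp add: coeff_index_0)
qed

text \<open>Induction on the sum of the indices: unless \<open>s\<close> is already packed, closing
  its first gap lowers this sum, and invariance under one \<open>zero_subst i\<close> shows that the
  coefficient is unchanged.\<close>

lemma coeff_packed:
  fixes P :: "'a :: {comm_semiring_0,comm_monoid_mult} bseries"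
  assumes inv: "\<And>i. i \<ge> 1 \<Longrightarrow> zero_subst i P = P"
    and "strict_mono_on {1..n} s" "\<And>k. k \<in> {1..n} \<Longrightarrow> 0 < s k"
  shows "coeff P (\<Sum>k=1..n. Poly_Mapping.single (s k) (\<alpha> k)) =
         coeff P (\<Sum>k=1..n. Poly_Mapping.single k (\<alpha> k))"
  using assms(2,3)
proof (induction "\<Sum>k=1..n. s k" arbitrary: s rule: less_induct)
  case less
  note mono = strict_mono_onD[OF less.prems(1)]
  show ?case
  proof (cases "\<forall>k\<in>{1..n}. s k = k")
    case True
    then show ?thesis by simp
  next
    case False
    \<comment> \<open>The first displaced position is also the first missing variable index: the
      indices before it are exactly 1 to \<open>i - 1\<close>, all later ones exceed
      \<open>i\<close>.\<close>
    define i where "i = (LEAST k. k \<in> {1..n} \<and> s k \<noteq> k)"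
    have i: "i \<in> {1..n}" "s i \<noteq> i"
      using LeastI_ex[of "\<lambda>k. k \<in> {1..n} \<and> s k \<noteq> k"] False unfolding i_def by blast+
    have below: "s k = k" if "k \<in> {1..n}" "k < i" for k
      using not_less_Least that unfolding i_def by blast
    have "i \<le> s i"
    proof (cases "i = 1")
      case True
      with less.prems(2) i show ?thesis by fastforce
    next
      case False
      with i have "s (i - 1) < s i" by (intro mono) auto
      with below[of "i - 1"] i False show ?thesis by auto
    qed
    with i have "i < s i" by simp
    have above: "i < s k" if "k \<in> {1..n}" "i \<le> k" for k
      using \<open>i < s i\<close> mono[of i k] i that by (cases "k = i") auto
    \<comment> \<open>The preimage of \<open>s\<close> under \<open>sigma i\<close>, which exists
      because \<open>s\<close> omits the value \<open>i\<close>. The case split is on the position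
      \<open>k\<close>, which by \<open>below\<close> and \<open>above\<close> agrees with splitting
      on \<open>s k < i\<close>.\<close>
    define s' where "s' k = (if k < i then s k else s k - 1)" for k
    have sigma_s': "sigma i (s' k) = s k" if "k \<in> {1..n}" for k
      using below[OF that] above[OF that] by (auto simp: s'_def sigma_def)
    have s'_mono: "strict_mono_on {1..n} s'"
      using sigma_s' mono strict_mono_less[OF strict_mono_sigma] by (intro strict_mono_onI) metis
    have s'_pos: "0 < s' k" if "k \<in> {1..n}" for k
      using less.prems(2)[OF that] above[OF that] i by (auto simp: s'_def)
    have "(\<Sum>k=1..n. s' k) < (\<Sum>k=1..n. s k)"
      by (rule sum_strict_mono_ex1) (use i \<open>i < s i\<close> in \<open>auto simp: s'_def intro!: bexI[of _ i]\<close>)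
    note IH = less.hyps[OF this s'_mono s'_pos]
    have "coeff P (\<Sum>k=1..n. Poly_Mapping.single (s k) (\<alpha> k)) =
          coeff P (\<Sum>k=1..n. Poly_Mapping.single (sigma i (s' k)) (\<alpha> k))"
      by (simp add: sigma_s')
    also have "\<dots> = coeff (zero_subst i P) (\<Sum>k=1..n. Poly_Mapping.single (s' k) (\<alpha> k))"
      using i s'_pos by (intro coeff_zero_subst[symmetric]) auto
    also have "\<dots> = coeff P (\<Sum>k=1..n. Poly_Mapping.single (s' k) (\<alpha> k))"
      using i by (simp add: inv)
    also note IH
    finally show ?thesis .
  qed
qed

theorem theorem3p11:
  fixes P :: "'a :: {comm_semiring_0,comm_monoid_mult} bseries"
  shows "P \<in> QSym \<longleftrightarrow> (\<forall>n\<ge>1. zero_subst n P = P)"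
proof
  assume "\<forall>n\<ge>1. zero_subst n P = P"
  \<comment> \<open>Both coefficients equal that of the packed monomial, which depends on \<alpha>
    alone.\<close>
  then show "P \<in> QSym"
    unfolding QSym_def using coeff_packed[of P] by simp
qed (simp add: zero_subst_QSym)

end
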